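(* Let $d,n\in\mathbb{N}$, $\bm s=(s_1,\dots,s_d)\in\mathbb{N}^d$ and $a,p\in\mathbb{R}$. Put $|\bm s|_r:=\sum_{i=1}^r s_i$ for $r=0,1,\dots,d$ (so $|\bm s|_0=0$) and $|\bm s|:=|\bm s|_d$. Then \[ \sum_{k=1}^n\binom nk p^k(1-p)^{n-k}\,\zeta_k^\star(s_1,\dots,s_d;a) =\sum_{n\ge n_1\ge\cdots\ge n_{|\bm s|}\ge 1} \frac{\prod_{r=1}^d(1-p)^{n_{|\bm s|_{r-1}+1}-n_{|\bm s|_r}}}{n_1\cdots n_{|\bm s|}}\Bigl[(1-p+ap)^{n_{|\bm s|}}-(1-p)^{n_{|\bm s|}}\Bigr]. \]
   Context: For $k\in\mathbb{N}$, positive integers $s_1,\dots,s_d$ and $a\in\mathbb{R}$, the generalized multiple harmonic-star value is $\zeta_k^\star(s_1,\dots,s_d;a):=\sum_{k\ge n_1\ge\cdots\ge n_d\ge 1}\frac{a^{n_d}}{n_1^{s_1}\cdots n_d^{s_d}}$ (the sum runs over integers). The convention $0^0=1$ is used. *)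

theory Defs
  imports Complex_Main "HOL-Library.FuncSet"
begin

text \<open>
  Tuples \<open>(n\<^sub>1, \<dots>, n\<^sub>m)\<close> are functions on the index set \<open>{1..m}\<close>. They are made extensional
  so that each tuple with \<open>N \<ge> n\<^sub>1 \<ge> \<dots> \<ge> n\<^sub>m \<ge> 1\<close> is counted exactly once in a sum.
\<close>

definition decr_tuples :: "nat \<Rightarrow> nat \<Rightarrow> (nat \<Rightarrow> nat) set" where
  "decr_tuples m N = {f \<in> {1..m} \<rightarrow>\<^sub>E {1..N}. \<forall>i\<in>{1..<m}. f (Suc i) \<le> f i}"

lemma finite_decr_tuples [simp]: "finite (decr_tuples m N)"
  unfolding decr_tuples_def
  by (rule finite_subset[of _ "{1..m} \<rightarrow>\<^sub>E {1..N}"]) (auto intro: finite_PiE)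

text \<open>
  The generalized multiple harmonic-star value \<open>\<zeta>\<^sub>k\<^sup>\<star>(s\<^sub>1, \<dots>, s\<^sub>d; a)\<close>, for \<open>d \<ge> 1\<close>;
  only \<open>s 1, \<dots>, s d\<close> are used.
\<close>

definition zeta_star :: "nat \<Rightarrow> nat \<Rightarrow> (nat \<Rightarrow> nat) \<Rightarrow> real \<Rightarrow> real" where
  "zeta_star k d s a =
     (\<Sum>m\<in>decr_tuples d k. a ^ m d / (\<Prod>i=1..d. real (m i) ^ s i))"

definition partial_weight :: "(nat \<Rightarrow> nat) \<Rightarrow> nat \<Rightarrow> nat" where
  "partial_weight s r = (\<Sum>i=1..r. s i)"

end

theory Submission
  imports Defs
begin

text \<open>
  Write \<open>B\<close> for the binomial transform and put \<open>q = 1 - p\<close>. Pascal's rule together with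
  \<open>(n choose (k - 1)) / k = ((n + 1) choose k) / (n + 1)\<close> gives first order recurrences in \<open>n\<close>,
  whose solutions say that \<open>B\<close> turns division by the index into the operator
  \<open>F \<mapsto> (\<lambda>n. \<Sum>j=1..n. q ^ (n - j) / j * F j)\<close>, and that it commutes with
  \<open>F \<mapsto> (\<lambda>n. \<Sum>j=1..n. F j / j)\<close>. Replacing \<open>a ^ n\<close> by an arbitrary function of the innermost
  index, one can strip the summation variables of \<open>\<zeta>\<^sup>\<star>\<close> from the innermost one outwards; each
  entry \<open>s\<^sub>r\<close> contributes one operator of the second and \<open>s\<^sub>r - 1\<close> operators of the first kind,
  and the powers of \<open>q\<close> inside such a block telescope.
\<close>

section \<open>Binomial transforms and weighted harmonic sums\<close>

definition binomial_transform :: "real \<Rightarrow> (nat \<Rightarrow> real) \<Rightarrow> nat \<Rightarrow> real" where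
  "binomial_transform p f n = (\<Sum>k=1..n. real (n choose k) * p ^ k * (1 - p) ^ (n - k) * f k)"

definition harmonic_sum :: "real \<Rightarrow> (nat \<Rightarrow> real) \<Rightarrow> nat \<Rightarrow> real" where
  "harmonic_sum q f n = (\<Sum>j=1..n. q ^ (n - j) / real j * f j)"

lemma harmonic_sum_0 [simp]: "harmonic_sum q f 0 = 0"
  by (simp add: harmonic_sum_def)

lemma harmonic_sum_Suc:
  "harmonic_sum q f (Suc n) = q * harmonic_sum q f n + f (Suc n) / real (Suc n)"
proof -
  have "(\<Sum>j=1..n. q ^ (Suc n - j) / real j * f j) = q * harmonic_sum q f n"
    unfolding harmonic_sum_def sum_distrib_left
    by (intro sum.cong) (auto simp: Suc_diff_le)
  then show ?thesis
    by (simp add: harmonic_sum_def)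
qed

text \<open>Reduces identities between operators to comparing one-step recurrences with initial
  value 0.\<close>

lemma harmonic_sum_unique:
  assumes "g 0 = 0" and "\<And>n. g (Suc n) = q * g n + f (Suc n) / real (Suc n)"
  shows "g = harmonic_sum q f"
proof
  show "g n = harmonic_sum q f n" for n
    by (induction n) (simp_all add: assms harmonic_sum_Suc del: of_nat_Suc)
qed

lemma binomial_transform_0 [simp]: "binomial_transform p f 0 = 0"
  by (simp add: binomial_transform_def)

text \<open>Pascal's rule: the part with \<open>n choose k\<close> loses its top term and yields the
  factor \<open>1 - p\<close>. The other part stays a sum, because its evaluation depends on the
  shape of \<open>f\<close>.\<close>

lemma binomial_transform_Suc:
  "binomial_transform p f (Suc n) = (1 - p) * binomial_transform p f n +
     (\<Sum>k=1..Suc n. real (n choose (k - 1)) * p ^ k * (1 - p) ^ (Suc n - k) * f k)"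
proof -
  have "binomial_transform p f (Suc n) =
      (\<Sum>k=1..Suc n. real (n choose k) * p ^ k * (1 - p) ^ (Suc n - k) * f k) +
      (\<Sum>k=1..Suc n. real (n choose (k - 1)) * p ^ k * (1 - p) ^ (Suc n - k) * f k)"
    unfolding binomial_transform_def sum.distrib[symmetric]
    by (intro sum.cong refl) (auto simp: choose_reduce_nat algebra_simps)
  also have "(\<Sum>k=1..Suc n. real (n choose k) * p ^ k * (1 - p) ^ (Suc n - k) * f k) =
      (\<Sum>k=1..n. real (n choose k) * p ^ k * (1 - p) ^ (Suc n - k) * f k)"
    by simp
  also have "\<dots> = (1 - p) * binomial_transform p f n"
    unfolding binomial_transform_def sum_distrib_left
    by (intro sum.cong) (auto simp: Suc_diff_le)
  finally show ?thesis .
qed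

text \<open>The absorption identity evaluates the sum left over in
  \<open>binomial_transform_Suc\<close> when the function carries a factor
  \<open>1 / k\<close>.\<close>

lemma sum_choose_pred_divide:
  "(\<Sum>k=1..Suc n. real (n choose (k - 1)) * p ^ k * (1 - p) ^ (Suc n - k) * (f k / real k)) =
     binomial_transform p f (Suc n) / real (Suc n)"
  unfolding binomial_transform_def sum_divide_distrib
proof (intro sum.cong refl)
  fix k assume "k \<in> {1..Suc n}"
  then obtain i where k: "k = Suc i"
    by (cases k) auto
  have "real (Suc i) * real (Suc n choose Suc i) = real (Suc n) * real (n choose i)"
    unfolding of_nat_mult[symmetric] by (simp only: Suc_times_binomial_eq mult.commute)
  then have "real (n choose i) / real (Suc i) = real (Suc n choose Suc i) / real (Suc n)"
    by (simp add: field_simps del: of_nat_Suc binomial_Suc_Suc)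
  then have "real (n choose i) / real (Suc i) * (p ^ k * (1 - p) ^ (Suc n - k) * f k) =
      real (Suc n choose Suc i) / real (Suc n) * (p ^ k * (1 - p) ^ (Suc n - k) * f k)"
    by simp
  then show "real (n choose (k - 1)) * p ^ k * (1 - p) ^ (Suc n - k) * (f k / real k) =
      real (Suc n choose k) * p ^ k * (1 - p) ^ (Suc n - k) * f k / real (Suc n)"
    unfolding k by (simp add: mult_ac del: of_nat_Suc binomial_Suc_Suc)
qed

lemma binomial_transform_divide:
  "binomial_transform p (\<lambda>k. f k / real k) = harmonic_sum (1 - p) (binomial_transform p f)"
  by (rule harmonic_sum_unique)
    (simp_all only: binomial_transform_0 binomial_transform_Suc[of p "\<lambda>k. f k / real k"]
      sum_choose_pred_divide)

lemma binomial_transform_divide_power: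
  "binomial_transform p (\<lambda>k. f k / real k ^ t) =
     (harmonic_sum (1 - p) ^^ t) (binomial_transform p f)"
proof (induction t)
  case (Suc t)
  have "(\<lambda>k. f k / real k ^ Suc t) = (\<lambda>k. f k / real k ^ t / real k)"
    by (simp add: field_simps)
  then show ?case
    by (simp only: binomial_transform_divide Suc funpow.simps o_apply)
qed simp

text \<open>The shifted part of the leftover sum contributes \<open>p\<close> times the transform,
  which completes the \<open>1 - p\<close> from Pascal's rule to the coefficient 1.\<close>

lemma binomial_transform_harmonic_sum:
  "binomial_transform p (harmonic_sum 1 f) = harmonic_sum 1 (binomial_transform p f)"
proof (rule harmonic_sum_unique)
  fix n
  let ?F = "harmonic_sum 1 f"
  let ?w = "\<lambda>k. real (n choose k) * p ^ k * (1 - p) ^ (n - k)"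
  let ?v = "\<lambda>k. real (n choose (k - 1)) * p ^ k * (1 - p) ^ (Suc n - k)"
  have "?F k = ?F (k - 1) + f k / real k" if "k \<in> {1..Suc n}" for k
    using that harmonic_sum_Suc[of 1 f "k - 1"] by simp
  then have "(\<Sum>k=1..Suc n. ?v k * ?F k) =
      (\<Sum>k=1..Suc n. ?v k * (?F (k - 1) + f k / real k))"
    by (intro sum.cong) auto
  also have "\<dots> = (\<Sum>k=1..Suc n. ?v k * ?F (k - 1)) + (\<Sum>k=1..Suc n. ?v k * (f k / real k))"
    by (simp only: distrib_left sum.distrib)
  also have "(\<Sum>k=1..Suc n. ?v k * ?F (k - 1)) = (\<Sum>k=0..n. ?v (Suc k) * ?F k)"
    using sum.shift_bounds_cl_Suc_ivl[of "\<lambda>k. ?v k * ?F (k - 1)" 0 n] by simp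
  also have "\<dots> = p * (\<Sum>k=0..n. ?w k * ?F k)"
    by (simp add: sum_distrib_left mult_ac)
  \<comment> \<open>The term at 0 vanishes because \<open>harmonic_sum\<close> is 0 there.\<close>
  also have "(\<Sum>k=0..n. ?w k * ?F k) = binomial_transform p ?F n"
    by (simp add: binomial_transform_def sum.atLeast_Suc_atMost[of 0 n])
  finally show "binomial_transform p ?F (Suc n) =
      1 * binomial_transform p ?F n + binomial_transform p f (Suc n) / real (Suc n)"
    by (simp only: binomial_transform_Suc[of p ?F] sum_choose_pred_divide)
      (simp add: algebra_simps)
qed simp

text \<open>Binomial theorem; the subtracted power is the term \<open>k = 0\<close>, which the
  transform omits.\<close>

lemma binomial_transform_power:
  "binomial_transform p (\<lambda>k. a ^ k) n = (1 - p + a * p) ^ n - (1 - p) ^ n"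
proof -
  have "(1 - p + a * p) ^ n = (a * p + (1 - p)) ^ n"
    by (simp add: add.commute)
  also have "\<dots> = (\<Sum>k=0..n. real (n choose k) * (a * p) ^ k * (1 - p) ^ (n - k))"
    unfolding binomial_ring atLeast0AtMost by simp
  also have "\<dots> = (1 - p) ^ n + binomial_transform p (\<lambda>k. a ^ k) n"
    by (simp add: binomial_transform_def sum.atLeast_Suc_atMost[of 0 n] power_mult_distrib mult_ac)
  finally show ?thesis
    by simp
qed

section \<open>Splitting off the last entries of decreasing tuples\<close>

text \<open>Setting \<open>n\<^sub>0 = N\<close> makes the empty tuple a valid base case for the inductions.\<close>

definition tuple_end :: "nat \<Rightarrow> nat \<Rightarrow> (nat \<Rightarrow> nat) \<Rightarrow> nat" where
  "tuple_end N M m = (if M = 0 then N else m M)"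

lemma tuple_end_Suc [simp]: "tuple_end N (Suc M) m = m (Suc M)"
  by (simp add: tuple_end_def)

lemma decr_tuples_0 [simp]: "decr_tuples 0 N = {\<lambda>_. undefined}"
  by (auto simp: decr_tuples_def)

lemma decr_tuples_antimono:
  assumes "m \<in> decr_tuples M N" "1 \<le> i" "i \<le> j" "j \<le> M"
  shows "m j \<le> m i"
  using assms(3,4)
proof (induction j rule: dec_induct)
  case (step k)
  with assms(1,2) have "m (Suc k) \<le> m k"
    by (auto simp: decr_tuples_def)
  with step show ?case
    by simp
qed simp

text \<open>Tuples are extensional, so dropping the last entry means resetting it to
  \<open>undefined\<close>. The new entry need only be compared with its predecessor, or with
  \<open>N\<close> if there is none.\<close>

lemma decr_tuples_Suc_iff:
  "m \<in> decr_tuples (Suc M) N \<longleftrightarrow>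
     m(Suc M := undefined) \<in> decr_tuples M N \<and> m (Suc M) \<in> {1..tuple_end N M m}"
  (is "?lhs \<longleftrightarrow> ?rhs")
proof
  assume ?lhs
  then show ?rhs
    by (auto simp: decr_tuples_def tuple_end_def PiE_iff extensional_def)
next
  assume R: ?rhs
  have range: "m i \<in> {1..N}" if "i \<in> {1..M}" for i
  proof -
    have "(m(Suc M := undefined)) i \<in> {1..N}"
      using R that unfolding decr_tuples_def by blast
    with that show ?thesis
      by simp
  qed
  have last: "m (Suc M) \<in> {1..N}"
    using R range[of M] by (auto simp: tuple_end_def split: if_splits)
  have ext: "m i = undefined" if "i \<notin> {1..Suc M}" for i
  proof -
    have "m(Suc M := undefined) \<in> {1..M} \<rightarrow>\<^sub>E {1..N}"
      using R by (simp add: decr_tuples_def)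
    then have "(m(Suc M := undefined)) i = undefined"
      by (rule PiE_arb) (use that in auto)
    with that show ?thesis
      by (simp split: if_splits)
  qed
  have decr: "m (Suc i) \<le> m i" if "i \<in> {1..<Suc M}" for i
  proof (cases "i = M")
    case True
    with R that show ?thesis
      by (auto simp: tuple_end_def)
  next
    case False
    with that have "(m(Suc M := undefined)) (Suc i) \<le> (m(Suc M := undefined)) i"
      using R unfolding decr_tuples_def by auto
    with False that show ?thesis
      by simp
  qed
  have "m i \<in> {1..N}" if "i \<in> {1..Suc M}" for i
    using that range[of i] last by (cases "i = Suc M") auto
  with ext decr show ?lhs
    unfolding decr_tuples_def by (auto simp: PiE_iff extensional_def)
qed

lemma sum_decr_tuples_Suc:
  "(\<Sum>m\<in>decr_tuples (Suc M) N. G m) =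
     (\<Sum>m\<in>decr_tuples M N. \<Sum>j=1..tuple_end N M m. G (m(Suc M := j)))"
proof -
  have undef: "m(Suc M := undefined) = m" if "m \<in> decr_tuples M N" for m
    using that by (auto simp: decr_tuples_def PiE_iff extensional_def)
  have "(\<Sum>m\<in>decr_tuples M N. \<Sum>j=1..tuple_end N M m. G (m(Suc M := j))) =
      (\<Sum>(m, j)\<in>(SIGMA m:decr_tuples M N. {1..tuple_end N M m}). G (m(Suc M := j)))"
    by (rule sum.Sigma) auto
  also have "\<dots> = (\<Sum>m\<in>decr_tuples (Suc M) N. G m)"
    by (rule sum.reindex_bij_witness[where
          i = "\<lambda>m. (m(Suc M := undefined), m (Suc M))" and j = "\<lambda>(m, j). m(Suc M := j)"])
      (auto simp: decr_tuples_Suc_iff undef tuple_end_def)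
  finally show ?thesis
    by simp
qed

text \<open>The assumption says that \<open>G\<close> reads only the first \<open>M\<close> entries.
  The block is summed from its innermost variable outwards, each sum being absorbed into
  \<open>F\<close>; the last one left has exponent 0, hence the outer
  \<open>harmonic_sum 1\<close>.\<close>

lemma sum_decr_tuples_block:
  assumes "\<And>m i j. i > M \<Longrightarrow> G (m(i := j)) = G m"
  shows "(\<Sum>m\<in>decr_tuples (M + Suc t) N.
      G m * (q ^ (m (M + 1) - m (M + Suc t)) / (\<Prod>j=M+1..M + Suc t. real (m j))) *
        F (m (M + Suc t))) =
    (\<Sum>m\<in>decr_tuples M N. G m * harmonic_sum 1 ((harmonic_sum q ^^ t) F) (tuple_end N M m))"
proof (induction t arbitrary: F)
  case 0
  show ?case
    by (simp add: sum_decr_tuples_Suc assms harmonic_sum_def sum_distrib_left mult_ac)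
next
  case (Suc t)
  let ?L = "M + Suc t"
  have "(\<Sum>m\<in>decr_tuples (Suc ?L) N.
      G m * (q ^ (m (M + 1) - m (Suc ?L)) / (\<Prod>j=M+1..Suc ?L. real (m j))) * F (m (Suc ?L))) =
    (\<Sum>m\<in>decr_tuples ?L N. \<Sum>j=1..m ?L.
      G m * (q ^ (m (M + 1) - j) / ((\<Prod>j=M+1..?L. real (m j)) * real j)) * F j)"
    unfolding sum_decr_tuples_Suc[where M = ?L] by (simp add: assms tuple_end_def)
  also have "\<dots> = (\<Sum>m\<in>decr_tuples ?L N.
      G m * (q ^ (m (M + 1) - m ?L) / (\<Prod>j=M+1..?L. real (m j))) * harmonic_sum q F (m ?L))"
    unfolding harmonic_sum_def sum_distrib_left
  proof (intro sum.cong refl)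
    fix m j assume m: "m \<in> decr_tuples ?L N" and j: "j \<in> {1..m ?L}"
    \<comment> \<open>Subtraction on \<open>nat\<close> truncates, so the exponents telescope only
      because \<open>j\<close>, \<open>m ?L\<close> and \<open>m (M + 1)\<close> are
      ordered.\<close>
    have "m ?L \<le> m (M + 1)"
      by (rule decr_tuples_antimono[OF m]) auto
    with j have "q ^ (m (M + 1) - j) = q ^ (m (M + 1) - m ?L) * q ^ (m ?L - j)"
      by (simp flip: power_add)
    then show "G m * (q ^ (m (M + 1) - j) / ((\<Prod>j=M+1..?L. real (m j)) * real j)) * F j =
      G m * (q ^ (m (M + 1) - m ?L) / (\<Prod>j=M+1..?L. real (m j))) *
        (q ^ (m ?L - j) / real j * F j)"
      by simp
  qed
  also have "\<dots> = (\<Sum>m\<in>decr_tuples M N.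
      G m * harmonic_sum 1 ((harmonic_sum q ^^ t) (harmonic_sum q F)) (tuple_end N M m))"
    by (rule Suc)
  finally show ?case
    by (simp add: funpow_swap1)
qed

section \<open>Induction on the depth, one block per entry of \<open>s\<close>\<close>

lemma partial_weight_0 [simp]: "partial_weight s 0 = 0"
  by (simp add: partial_weight_def)

lemma partial_weight_Suc [simp]: "partial_weight s (Suc r) = partial_weight s r + s (Suc r)"
  by (simp add: partial_weight_def)

lemma partial_weight_mono: "i \<le> j \<Longrightarrow> partial_weight s i \<le> partial_weight s j"
  unfolding partial_weight_def by (rule sum_mono2) auto

text \<open>\<open>f\<close> is general because summing out the innermost variable replaces it by
  another function. For \<open>d = 0\<close> both sides are the transform of
  \<open>f\<close>.\<close>

lemma binomial_transform_sum_decr_tuples: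
  assumes "\<And>i. i \<in> {1..d} \<Longrightarrow> s i \<ge> 1"
  shows "binomial_transform p
      (\<lambda>k. \<Sum>m\<in>decr_tuples d k. f (tuple_end k d m) / (\<Prod>i=1..d. real (m i) ^ s i)) n =
    (\<Sum>m\<in>decr_tuples (partial_weight s d) n.
       (\<Prod>r=1..d. (1 - p) ^ (m (partial_weight s (r - 1) + 1) - m (partial_weight s r)))
         / (\<Prod>j=1..partial_weight s d. real (m j))
       * binomial_transform p f (tuple_end n (partial_weight s d) m))"
  using assms
proof (induction d arbitrary: f)
  case 0
  show ?case
    by (simp add: tuple_end_def)
next
  case (Suc d)
  let ?P = "partial_weight s"
  obtain t where t: "s (Suc d) = Suc t"
    using Suc.prems[of "Suc d"] by (cases "s (Suc d)") auto
  \<comment> \<open>Result of summing out the innermost variable: one factor \<open>1 / j\<close>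
    goes into \<open>harmonic_sum 1\<close>, and the other \<open>t\<close> become iterates of
    \<open>harmonic_sum (1 - p)\<close> under the transform.\<close>
  define g where "g = harmonic_sum 1 (\<lambda>j. f j / real j ^ t)"
  define G :: "(nat \<Rightarrow> nat) \<Rightarrow> real" where
    "G m = (\<Prod>r=1..d. (1 - p) ^ (m (?P (r - 1) + 1) - m (?P r))) / (\<Prod>j=1..?P d. real (m j))"
    for m
  \<comment> \<open>Positivity of \<open>s r\<close> gives
    \<open>?P (r - 1) + 1 \<le> ?P r \<le> ?P d\<close>, so every index that \<open>G\<close> reads
    is at most \<open>?P d\<close>.\<close>
  have G_upd: "G (m(i := j)) = G m" if "i > ?P d" for m i j
  proof -
    have "?P (r - 1) + 1 \<noteq> i \<and> ?P r \<noteq> i" if r: "r \<in> {1..d}" for r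
    proof -
      have "?P r = ?P (r - 1) + s r"
        using r partial_weight_Suc[of s "r - 1"] by simp
      moreover have "s r \<ge> 1"
        using Suc.prems[of r] r by simp
      moreover have "?P r \<le> ?P d"
        using r by (intro partial_weight_mono) simp
      ultimately show ?thesis
        using \<open>i > ?P d\<close> by linarith
    qed
    then show ?thesis
      unfolding G_def using that
      by (intro arg_cong2[of _ _ _ _ "(/)"] prod.cong) auto
  qed
  have "(\<Sum>m\<in>decr_tuples (Suc d) k. f (tuple_end k (Suc d) m) / (\<Prod>i=1..Suc d. real (m i) ^ s i))
      = (\<Sum>m\<in>decr_tuples d k. g (tuple_end k d m) / (\<Prod>i=1..d. real (m i) ^ s i))" for k
    by (simp add: sum_decr_tuples_Suc g_def harmonic_sum_def sum_divide_distrib t mult_ac)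
  then have "binomial_transform p
      (\<lambda>k. \<Sum>m\<in>decr_tuples (Suc d) k.
        f (tuple_end k (Suc d) m) / (\<Prod>i=1..Suc d. real (m i) ^ s i)) n =
      (\<Sum>m\<in>decr_tuples (?P d) n. G m * binomial_transform p g (tuple_end n (?P d) m))"
    using Suc.IH[of g] Suc.prems by (simp add: G_def)
  also have "\<dots> = (\<Sum>m\<in>decr_tuples (?P d) n. G m *
      harmonic_sum 1 ((harmonic_sum (1 - p) ^^ t) (binomial_transform p f)) (tuple_end n (?P d) m))"
    by (simp only: g_def binomial_transform_harmonic_sum binomial_transform_divide_power)
  \<comment> \<open>The block lemma read backwards unfolds the operators into
    \<open>s (Suc d)\<close> new variables.\<close>
  also have "\<dots> = (\<Sum>m\<in>decr_tuples (?P d + Suc t) n.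
      G m * ((1 - p) ^ (m (?P d + 1) - m (?P d + Suc t)) / (\<Prod>j=?P d+1..?P d + Suc t. real (m j))) *
        binomial_transform p f (m (?P d + Suc t)))"
    by (rule sum_decr_tuples_block[symmetric]) (rule G_upd)
  also have "\<dots> = (\<Sum>m\<in>decr_tuples (?P (Suc d)) n.
       (\<Prod>r=1..Suc d. (1 - p) ^ (m (?P (r - 1) + 1) - m (?P r)))
         / (\<Prod>j=1..?P (Suc d). real (m j))
       * binomial_transform p f (tuple_end n (?P (Suc d)) m))"
  proof -
    have block: "(\<Prod>j=1..?P d + Suc t. real (m j)) =
        (\<Prod>j=1..?P d. real (m j)) * (\<Prod>j=?P d+1..?P d + Suc t. real (m j))" for m
      by (rule prod.ub_add_nat) simp
    have factor: "(\<Prod>r=1..Suc d. (1 - p) ^ (m (?P (r - 1) + 1) - m (?P r))) =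
        (\<Prod>r=1..d. (1 - p) ^ (m (?P (r - 1) + 1) - m (?P r))) *
          (1 - p) ^ (m (?P d + 1) - m (?P d + Suc t))" for m
      by (simp add: t)
    have last: "tuple_end n (?P d + Suc t) m = m (?P d + Suc t)" for m
      by simp
    show ?thesis
      by (simp only: partial_weight_Suc t block factor last G_def times_divide_times_eq)
  qed
  finally show ?case .
qed

theorem theorem2:
  fixes d n :: nat and s :: "nat \<Rightarrow> nat" and a p :: real
  assumes "d \<ge> 1" and "n \<ge> 1" and "\<And>i. i \<in> {1..d} \<Longrightarrow> s i \<ge> 1"
  shows "(\<Sum>k=1..n. real (n choose k) * p ^ k * (1 - p) ^ (n - k) * zeta_star k d s a) =
    (\<Sum>m\<in>decr_tuples (partial_weight s d) n.
       (\<Prod>r=1..d. (1 - p) ^ (m (partial_weight s (r - 1) + 1) - m (partial_weight s r)))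
         / (\<Prod>j=1..partial_weight s d. real (m j))
       * ((1 - p + a * p) ^ m (partial_weight s d) - (1 - p) ^ m (partial_weight s d)))"
proof -
  \<comment> \<open>The total weight is positive, so \<open>tuple_end\<close> is a genuine last
    entry.\<close>
  have "partial_weight s 1 \<le> partial_weight s d"
    using assms(1) by (rule partial_weight_mono)
  moreover have "partial_weight s 1 \<ge> 1"
    using assms(1) assms(3)[of 1] by simp
  ultimately have "partial_weight s d \<noteq> 0"
    by linarith
  with assms(1) show ?thesis
    using binomial_transform_sum_decr_tuples[of d s p "\<lambda>k. a ^ k" n, OF assms(3)]
    unfolding binomial_transform_power
    by (simp add: binomial_transform_def zeta_star_def tuple_end_def)
qed

end
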